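(* Let $\varphi$ be an equality-free sentence which is a Horn clause or a w-Horn clause. Then $\varphi$ has a model if and only if it has an H-model.
   Context: **Semantics.** MTL-algebras are bounded integral commutative residuated lattices $(A,\sqcap,\sqcup,*,\Rightarrow,0,1)$ satisfying $(x\Rightarrow y)\sqcup(y\Rightarrow x)=1$; the connectives $\wedge$ (weak conjunction), $\vee$, $\&$ (strong conjunction), $\rightarrow,\overline 0,\overline 1$ are interpreted by $\sqcap,\sqcup,*,\Rightarrow,0,1$. The only propositional truth-constants are $\overline 0,\overline 1$. A predicate language consists of a nonempty set of predicate symbols, a set of function symbols, and arities (0-ary function symbols are individual constants, 0-ary predicate symbols are truth constants). Terms, formulas and sentences are as in classical predicate logic. For an MTL-algebra $\mathbf A$, an $\mathbf A$-structure $\mathbf M$ has a nonempty domain $M$, a function $P_{\mathbf M}:M^n\to\mathbf A$ for each $n$-ary predicate symbol $P$ (an element of $\mathbf{A}$ if $n=0$), and $F_{\mathbf M}:M^n\to M$ for each $n$-ary function symbol $F$ (an element of $M$ if $n=0$). Truth values $\|\varphi\|^{\mathbf A}_{\mathbf M,v}$ for evaluations $v$ of the variables in $M$ are defined recursively as usual, connectives being interpreted by the operations of $\mathbf A$, $\forall$ by infimum and $\exists$ by supremum over $M$ (undefined if these do not exist). $\langle\mathbf A,\mathbf M\rangle$ is a model of a set of formulas if each of them has value $1$ under all evaluations. **Equality.** The symbol $\approx$ is interpreted always as the crisp identity, and the language has at least one individual constant. A formula is equality-free if $\approx$ does not occur in it. **Horn clauses.** A basic Horn formula is a formula $\alpha_1\&\cdots\&\alpha_n\rightarrow\beta$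 with $n\in\mathbb N$ and $\alpha_1,\dots,\alpha_n,\beta$ atomic (for $n=0$ it is just the atomic formula $\beta$); a basic w-Horn formula is the same with $\wedge$ in place of $\&$. A quantifier-free Horn formula is $\phi_1\&\cdots\&\phi_m$ with each $\phi_i$ a basic Horn formula; a quantifier-free w-Horn formula is $\phi_1\wedge\cdots\wedge\phi_m$ with each $\phi_i$ a basic w-Horn formula. A (w-)Horn clause is a formula $Q\gamma$ with $Q$ a (possibly empty) string of universal quantifiers and $\gamma$ a quantifier-free (w-)Horn formula. **H-structures.** Let $\overline H$ be the set of all equality-free sentences $P(t_1,\dots,t_n)$ with $t_1,\dots,t_n$ ground terms (terms without variables), $n\ge1$ and $P$ an $n$-ary predicate symbol. For $H\subseteq\overline H$, the H-structure $\langle\mathbf B,\mathbf N^{H}\rangle$ has $\mathbf B$ the two-valued Boolean algebra, domain the set of all ground terms, $c_{\mathbf N^H}=c$ for individual constants $c$, $F_{\mathbf N^H}(t_1,\dots,t_n)=F(t_1,\dots,t_n)$ for $n$-ary function symbols $F$, and for every $n\ge1$ and $n$-ary predicate symbol $P$, $P_{\mathbf N^H}(t_1,\dots,t_n)=1$ if $P(t_1,\dots,t_n)\in H$ and $0$ otherwise. An H-model of a set of sentences is an H-structure that is a model of it.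
   Formalization: "Has a model" is read as having a model over an MTL-algebra with 0 ≠ 1; over the one-element algebra every structure is a model, e.g. of P(c) & (P(c) → 0), which has no H-model, so the statement would fail. *)

theory Defs
  imports "HOL-Algebra.Lattice" "HOL-Algebra.Group"
begin

section \<open>MTL-algebras\<close>

record 'a mtl = "'a gorder" +
  star :: "'a \<Rightarrow> 'a \<Rightarrow> 'a"
  residuum :: "'a \<Rightarrow> 'a \<Rightarrow> 'a"

text \<open>Integrality is the requirement that the unit of \<^term>\<open>star A\<close> is the top element.\<close>

locale mtl_algebra = bounded_lattice A for A :: "('a, 'b) mtl_scheme" (structure) +
  assumes star_comm_monoid:
      "comm_monoid \<lparr>carrier = carrier A, monoid.mult = star A, one = \<top>\<rparr>"
    and residuum_closed:
      "\<lbrakk>x \<in> carrier A; y \<in> carrier A\<rbrakk> \<Longrightarrow> residuum A x y \<in> carrier A"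
    and residuation:
      "\<lbrakk>x \<in> carrier A; y \<in> carrier A; z \<in> carrier A\<rbrakk>
        \<Longrightarrow> star A x y \<sqsubseteq> z \<longleftrightarrow> x \<sqsubseteq> residuum A y z"
    and prelinearity:
      "\<lbrakk>x \<in> carrier A; y \<in> carrier A\<rbrakk> \<Longrightarrow> residuum A x y \<squnion> residuum A y x = \<top>"

definition two :: "bool mtl" where
  "two = \<lparr>carrier = UNIV, eq = (=), le = (\<le>), star = (\<and>), residuum = (\<longrightarrow>)\<rparr>"


section \<open>Syntax\<close>

record ('f, 'p) lang =
  funs :: "'f set"
  preds :: "'p set"
  farity :: "'f \<Rightarrow> nat"
  parity :: "'p \<Rightarrow> nat"

datatype 'f trm = Var nat | Fun 'f "'f trm list"

text \<open>\<open>Zero\<close> and \<open>One\<close> are the truth constants; \<open>SConj\<close> is the strong conjunction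
  \<open>&\<close> and \<open>WConj\<close> the weak conjunction; \<open>Eql\<close> is the equality symbol, which is not one of
  the predicate symbols in \<^const>\<open>preds\<close>.\<close>

datatype ('f, 'p) fm =
    Pred 'p "'f trm list"
  | Eql "'f trm" "'f trm"
  | Zero
  | One
  | WConj "('f, 'p) fm" "('f, 'p) fm"
  | Disj "('f, 'p) fm" "('f, 'p) fm"
  | SConj "('f, 'p) fm" "('f, 'p) fm"
  | Imp "('f, 'p) fm" "('f, 'p) fm"
  | All nat "('f, 'p) fm"
  | Ex nat "('f, 'p) fm"

primrec trm_vars :: "'f trm \<Rightarrow> nat set" where
  "trm_vars (Var x) = {x}"
| "trm_vars (Fun f ts) = \<Union> (set (map trm_vars ts))"

primrec wf_trm :: "('f, 'p) lang \<Rightarrow> 'f trm \<Rightarrow> bool" where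
  "wf_trm L (Var x) \<longleftrightarrow> True"
| "wf_trm L (Fun f ts) \<longleftrightarrow> f \<in> funs L \<and> length ts = farity L f \<and> list_all (\<lambda>b. b) (map (wf_trm L) ts)"

definition ground_terms :: "('f, 'p) lang \<Rightarrow> 'f trm set" where
  "ground_terms L = {t. wf_trm L t \<and> trm_vars t = {}}"

primrec wf_fm :: "('f, 'p) lang \<Rightarrow> ('f, 'p) fm \<Rightarrow> bool" where
  "wf_fm L (Pred p ts) \<longleftrightarrow> p \<in> preds L \<and> length ts = parity L p \<and> (\<forall>t \<in> set ts. wf_trm L t)"
| "wf_fm L (Eql s t) \<longleftrightarrow> wf_trm L s \<and> wf_trm L t"
| "wf_fm L Zero \<longleftrightarrow> True"
| "wf_fm L One \<longleftrightarrow> True"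
| "wf_fm L (WConj \<phi> \<psi>) \<longleftrightarrow> wf_fm L \<phi> \<and> wf_fm L \<psi>"
| "wf_fm L (Disj \<phi> \<psi>) \<longleftrightarrow> wf_fm L \<phi> \<and> wf_fm L \<psi>"
| "wf_fm L (SConj \<phi> \<psi>) \<longleftrightarrow> wf_fm L \<phi> \<and> wf_fm L \<psi>"
| "wf_fm L (Imp \<phi> \<psi>) \<longleftrightarrow> wf_fm L \<phi> \<and> wf_fm L \<psi>"
| "wf_fm L (All x \<phi>) \<longleftrightarrow> wf_fm L \<phi>"
| "wf_fm L (Ex x \<phi>) \<longleftrightarrow> wf_fm L \<phi>"

primrec free_vars :: "('f, 'p) fm \<Rightarrow> nat set" where
  "free_vars (Pred p ts) = (\<Union>t \<in> set ts. trm_vars t)"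
| "free_vars (Eql s t) = trm_vars s \<union> trm_vars t"
| "free_vars Zero = {}"
| "free_vars One = {}"
| "free_vars (WConj \<phi> \<psi>) = free_vars \<phi> \<union> free_vars \<psi>"
| "free_vars (Disj \<phi> \<psi>) = free_vars \<phi> \<union> free_vars \<psi>"
| "free_vars (SConj \<phi> \<psi>) = free_vars \<phi> \<union> free_vars \<psi>"
| "free_vars (Imp \<phi> \<psi>) = free_vars \<phi> \<union> free_vars \<psi>"
| "free_vars (All x \<phi>) = free_vars \<phi> - {x}"
| "free_vars (Ex x \<phi>) = free_vars \<phi> - {x}"

definition sentence :: "('f, 'p) lang \<Rightarrow> ('f, 'p) fm \<Rightarrow> bool" where
  "sentence L \<phi> \<longleftrightarrow> wf_fm L \<phi> \<and> free_vars \<phi> = {}"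

primrec equality_free :: "('f, 'p) fm \<Rightarrow> bool" where
  "equality_free (Pred p ts) \<longleftrightarrow> True"
| "equality_free (Eql s t) \<longleftrightarrow> False"
| "equality_free Zero \<longleftrightarrow> True"
| "equality_free One \<longleftrightarrow> True"
| "equality_free (WConj \<phi> \<psi>) \<longleftrightarrow> equality_free \<phi> \<and> equality_free \<psi>"
| "equality_free (Disj \<phi> \<psi>) \<longleftrightarrow> equality_free \<phi> \<and> equality_free \<psi>"
| "equality_free (SConj \<phi> \<psi>) \<longleftrightarrow> equality_free \<phi> \<and> equality_free \<psi>"
| "equality_free (Imp \<phi> \<psi>) \<longleftrightarrow> equality_free \<phi> \<and> equality_free \<psi>"
| "equality_free (All x \<phi>) \<longleftrightarrow> equality_free \<phi>"
| "equality_free (Ex x \<phi>) \<longleftrightarrow> equality_free \<phi>"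


section \<open>Horn clauses\<close>

primrec atomic :: "('f, 'p) fm \<Rightarrow> bool" where
  "atomic (Pred p ts) \<longleftrightarrow> True"
| "atomic (Eql s t) \<longleftrightarrow> True"
| "atomic Zero \<longleftrightarrow> True"
| "atomic One \<longleftrightarrow> True"
| "atomic (WConj \<phi> \<psi>) \<longleftrightarrow> False"
| "atomic (Disj \<phi> \<psi>) \<longleftrightarrow> False"
| "atomic (SConj \<phi> \<psi>) \<longleftrightarrow> False"
| "atomic (Imp \<phi> \<psi>) \<longleftrightarrow> False"
| "atomic (All x \<phi>) \<longleftrightarrow> False"
| "atomic (Ex x \<phi>) \<longleftrightarrow> False"

text \<open>Nonempty finite conjunctions, built with the connective \<open>c\<close> and bracketed in any way,
  of formulas satisfying \<open>P\<close>.\<close>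

inductive conj_of ::
  "(('f, 'p) fm \<Rightarrow> ('f, 'p) fm \<Rightarrow> ('f, 'p) fm) \<Rightarrow> (('f, 'p) fm \<Rightarrow> bool) \<Rightarrow> ('f, 'p) fm \<Rightarrow> bool"
  for c P where
  single: "P \<phi> \<Longrightarrow> conj_of c P \<phi>"
| conj: "conj_of c P \<phi> \<Longrightarrow> conj_of c P \<psi> \<Longrightarrow> conj_of c P (c \<phi> \<psi>)"

text \<open>The connective \<open>c\<close> is \<^const>\<open>SConj\<close> for Horn and \<^const>\<open>WConj\<close> for w-Horn formulas.\<close>

definition basic_horn_with ::
  "(('f, 'p) fm \<Rightarrow> ('f, 'p) fm \<Rightarrow> ('f, 'p) fm) \<Rightarrow> ('f, 'p) fm \<Rightarrow> bool" where
  "basic_horn_with c \<phi> \<longleftrightarrow>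
     atomic \<phi> \<or> (\<exists>\<alpha> \<beta>. \<phi> = Imp \<alpha> \<beta> \<and> conj_of c atomic \<alpha> \<and> atomic \<beta>)"

inductive horn_clause_with ::
  "(('f, 'p) fm \<Rightarrow> ('f, 'p) fm \<Rightarrow> ('f, 'p) fm) \<Rightarrow> ('f, 'p) fm \<Rightarrow> bool"
  for c where
  quantifier_free: "conj_of c (basic_horn_with c) \<gamma> \<Longrightarrow> horn_clause_with c \<gamma>"
| universal: "horn_clause_with c \<phi> \<Longrightarrow> horn_clause_with c (All x \<phi>)"

definition horn_clause :: "('f, 'p) fm \<Rightarrow> bool" where
  "horn_clause = horn_clause_with SConj"

definition w_horn_clause :: "('f, 'p) fm \<Rightarrow> bool" where
  "w_horn_clause = horn_clause_with WConj"


section \<open>Semantics\<close>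

record ('f, 'p, 'a, 'm) struct =
  dom :: "'m set"
  fun_of :: "'f \<Rightarrow> 'm list \<Rightarrow> 'm"
  pred_of :: "'p \<Rightarrow> 'm list \<Rightarrow> 'a"

definition is_struct :: "('f, 'p) lang \<Rightarrow> 'a mtl \<Rightarrow> ('f, 'p, 'a, 'm) struct \<Rightarrow> bool" where
  "is_struct L A M \<longleftrightarrow>
     dom M \<noteq> {} \<and>
     (\<forall>f \<in> funs L. \<forall>ms. length ms = farity L f \<and> set ms \<subseteq> dom M \<longrightarrow> fun_of M f ms \<in> dom M) \<and>
     (\<forall>p \<in> preds L. \<forall>ms. length ms = parity L p \<and> set ms \<subseteq> dom M \<longrightarrow> pred_of M p ms \<in> carrier A)"

primrec trm_val :: "('f, 'p, 'a, 'm) struct \<Rightarrow> (nat \<Rightarrow> 'm) \<Rightarrow> 'f trm \<Rightarrow> 'm" where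
  "trm_val M v (Var x) = v x"
| "trm_val M v (Fun f ts) = fun_of M f (map (trm_val M v) ts)"

text \<open>Truth values are partial: \<^const>\<open>None\<close> stands for an undefined value. Since
  \<^term>\<open>inf A S\<close> and \<^term>\<open>sup A S\<close> are chosen by \<open>SOME\<close>, the existence of these bounds
  has to be tested separately.\<close>

fun lift2 :: "('a \<Rightarrow> 'a \<Rightarrow> 'a) \<Rightarrow> 'a option \<Rightarrow> 'a option \<Rightarrow> 'a option" where
  "lift2 h (Some x) (Some y) = Some (h x y)"
| "lift2 h _ _ = None"

definition inf_option :: "'a mtl \<Rightarrow> 'a option set \<Rightarrow> 'a option" where
  "inf_option A S =
     (if None \<notin> S \<and> (\<exists>i. greatest A i (Lower A (the ` S))) then Some (\<Sqinter>\<^bsub>A\<^esub>(the ` S)) else None)"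

definition sup_option :: "'a mtl \<Rightarrow> 'a option set \<Rightarrow> 'a option" where
  "sup_option A S =
     (if None \<notin> S \<and> (\<exists>s. least A s (Upper A (the ` S))) then Some (\<Squnion>\<^bsub>A\<^esub>(the ` S)) else None)"

primrec truth_val ::
  "'a mtl \<Rightarrow> ('f, 'p, 'a, 'm) struct \<Rightarrow> ('f, 'p) fm \<Rightarrow> (nat \<Rightarrow> 'm) \<Rightarrow> 'a option" where
  "truth_val A M (Pred p ts) v = Some (pred_of M p (map (trm_val M v) ts))"
| "truth_val A M (Eql s t) v = Some (if trm_val M v s = trm_val M v t then \<top>\<^bsub>A\<^esub> else \<bottom>\<^bsub>A\<^esub>)"
| "truth_val A M Zero v = Some \<bottom>\<^bsub>A\<^esub>"
| "truth_val A M One v = Some \<top>\<^bsub>A\<^esub>"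
| "truth_val A M (WConj \<phi> \<psi>) v = lift2 (meet A) (truth_val A M \<phi> v) (truth_val A M \<psi> v)"
| "truth_val A M (Disj \<phi> \<psi>) v = lift2 (join A) (truth_val A M \<phi> v) (truth_val A M \<psi> v)"
| "truth_val A M (SConj \<phi> \<psi>) v = lift2 (star A) (truth_val A M \<phi> v) (truth_val A M \<psi> v)"
| "truth_val A M (Imp \<phi> \<psi>) v = lift2 (residuum A) (truth_val A M \<phi> v) (truth_val A M \<psi> v)"
| "truth_val A M (All x \<phi>) v = inf_option A ((\<lambda>m. truth_val A M \<phi> (v(x := m))) ` dom M)"
| "truth_val A M (Ex x \<phi>) v = sup_option A ((\<lambda>m. truth_val A M \<phi> (v(x := m))) ` dom M)"

definition is_model :: "'a mtl \<Rightarrow> ('f, 'p, 'a, 'm) struct \<Rightarrow> ('f, 'p) fm set \<Rightarrow> bool" where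
  "is_model A M \<Phi> \<longleftrightarrow>
     (\<forall>\<phi> \<in> \<Phi>. \<forall>v. range v \<subseteq> dom M \<longrightarrow> truth_val A M \<phi> v = Some \<top>\<^bsub>A\<^esub>)"

text \<open>Existence of a model whose algebra and domain have their carriers in the types \<open>'a\<close> and
  \<open>'m\<close>. The one-element algebra is excluded: a crisp identity needs two distinct truth values,
  and over the one-element algebra every structure would be a model even of \<^const>\<open>Zero\<close>.
  Since HOL has no quantification over types inside a formula, a hypothesis ``there is a model'' is
  stated for arbitrary type variables, and a conclusion ``there is a model'' names the types.\<close>

definition has_model ::
  "'a itself \<Rightarrow> 'm itself \<Rightarrow> ('f, 'p) lang \<Rightarrow> ('f, 'p) fm set \<Rightarrow> bool" where
  "has_model (_ :: 'a itself) (_ :: 'm itself) L \<Phi> \<longleftrightarrow>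
     (\<exists>(A :: 'a mtl) (M :: ('f, 'p, 'a, 'm) struct).
        mtl_algebra A \<and> \<bottom>\<^bsub>A\<^esub> \<noteq> \<top>\<^bsub>A\<^esub> \<and> is_struct L A M \<and> is_model A M \<Phi>)"


section \<open>H-structures\<close>

definition ground_atoms :: "('f, 'p) lang \<Rightarrow> ('f, 'p) fm set" where
  "ground_atoms L =
     {Pred p ts | p ts. p \<in> preds L \<and> parity L p \<ge> 1 \<and> length ts = parity L p
                        \<and> set ts \<subseteq> ground_terms L}"

text \<open>The set \<open>H\<close> determines only the predicates of arity at least 1. If the language contains
  0-ary predicate symbols, their truth values in the H-structure are arbitrary.\<close>

definition is_H_struct ::
  "('f, 'p) lang \<Rightarrow> ('f, 'p) fm set \<Rightarrow> ('f, 'p, bool, 'f trm) struct \<Rightarrow> bool" where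
  "is_H_struct L H N \<longleftrightarrow>
     dom N = ground_terms L \<and>
     (\<forall>f \<in> funs L. \<forall>ts. length ts = farity L f \<and> set ts \<subseteq> ground_terms L
        \<longrightarrow> fun_of N f ts = Fun f ts) \<and>
     (\<forall>p \<in> preds L. \<forall>ts. parity L p \<ge> 1 \<and> length ts = parity L p \<and> set ts \<subseteq> ground_terms L
        \<longrightarrow> pred_of N p ts = (Pred p ts \<in> H))"

definition has_H_model :: "('f, 'p) lang \<Rightarrow> ('f, 'p) fm set \<Rightarrow> bool" where
  "has_H_model L \<Phi> \<longleftrightarrow>
     (\<exists>H N. H \<subseteq> ground_atoms L \<and> is_H_struct L H N \<and> is_model two N \<Phi>)"

end

theory Submission
  imports Defs
begin

text \<open>Given a model \<open>\<langle>A, M\<rangle>\<close>, let \<open>H\<close> consist of the ground atoms that have the value \<open>1\<close> in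
  \<open>M\<close>. The interpretation of ground terms in \<open>M\<close> turns an evaluation \<open>w\<close> in ground terms into an
  evaluation in \<open>M\<close>, and an equality-free atomic formula is true under \<open>w\<close> in the H-structure iff
  it has the value \<open>1\<close> under the latter. Since a strong or weak conjunction has the value \<open>1\<close> iff
  both conjuncts do, and \<open>1 \<Rightarrow> y = 1\<close> only for \<open>y = 1\<close>, the value \<open>1\<close> of basic Horn formulas
  passes from \<open>M\<close> to the H-structure, and hence so does that of Horn clauses.\<close>

section \<open>The value 1 in structures over MTL-algebras\<close>

lemma (in mtl_algebra) star_closed:
  "x \<in> carrier A \<Longrightarrow> y \<in> carrier A \<Longrightarrow> star A x y \<in> carrier A"
  using comm_monoid.axioms(1)[OF star_comm_monoid] monoid.m_closed by fastforce

lemma (in mtl_algebra) star_comm: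
  "x \<in> carrier A \<Longrightarrow> y \<in> carrier A \<Longrightarrow> star A x y = star A y x"
  using comm_monoid.m_comm[OF star_comm_monoid] by fastforce

lemma (in mtl_algebra) star_top [simp]: "x \<in> carrier A \<Longrightarrow> star A x \<top> = x"
  using monoid.r_one[OF comm_monoid.axioms(1)[OF star_comm_monoid]] by fastforce

text \<open>Residuation with \<open>\<top>\<close> as the other factor: as the unit it leaves
  \<open>x\<close> unchanged, and as the top element it has only itself above it.\<close>

lemma (in mtl_algebra) residuum_eq_top_iff:
  assumes "x \<in> carrier A" "y \<in> carrier A"
  shows "residuum A x y = \<top> \<longleftrightarrow> x \<sqsubseteq> y"
proof -
  have "x \<sqsubseteq> y \<longleftrightarrow> \<top> \<sqsubseteq> residuum A x y"
    using residuation[of \<top> x y] assms star_comm[of \<top> x] by simp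
  then show ?thesis
    using assms residuum_closed by (metis le_antisym top_closed top_higher)
qed

lemma (in mtl_algebra) top_le_iff: "x \<in> carrier A \<Longrightarrow> \<top> \<sqsubseteq> x \<longleftrightarrow> x = \<top>"
  by (metis le_antisym top_closed top_higher)

text \<open>By integrality \<open>y\<close> lies below \<open>residuum A x x = \<top>\<close>;
  residuation turns this into the claim, up to commutativity.\<close>

lemma (in mtl_algebra) star_le_left:
  assumes "x \<in> carrier A" "y \<in> carrier A"
  shows "star A x y \<sqsubseteq> x"
proof -
  have "y \<sqsubseteq> residuum A x x"
    using residuum_eq_top_iff[of x x] assms by simp
  then have "star A y x \<sqsubseteq> x"
    using residuation assms by simp
  then show ?thesis
    using star_comm assms by simp
qed

lemma (in mtl_algebra) star_eq_top_iff:
  assumes "x \<in> carrier A" "y \<in> carrier A"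
  shows "star A x y = \<top> \<longleftrightarrow> x = \<top> \<and> y = \<top>"
proof
  assume "star A x y = \<top>"
  then show "x = \<top> \<and> y = \<top>"
    using star_le_left[of x y] star_le_left[of y x] star_comm[of x y] assms
    by (simp add: top_le_iff)
qed (use assms in auto)

lemma (in mtl_algebra) meet_eq_top_iff:
  assumes "x \<in> carrier A" "y \<in> carrier A"
  shows "x \<sqinter> y = \<top> \<longleftrightarrow> x = \<top> \<and> y = \<top>"
proof -
  have "\<top> \<sqsubseteq> x \<sqinter> y \<longleftrightarrow> \<top> \<sqsubseteq> x \<and> \<top> \<sqsubseteq> y"
    using assms meet_left meet_right meet_le by (meson le_trans meet_closed top_closed)
  then show ?thesis
    using assms by (simp add: top_le_iff)
qed

lemma (in mtl_algebra) greatest_Lower_top: "S \<subseteq> {\<top>} \<Longrightarrow> greatest A \<top> (Lower A S)"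
  by (auto simp: greatest_def Lower_def)

text \<open>\<open>inf\<close> is chosen by \<open>SOME\<close>, so it is an infimum only once
  existence is known.\<close>

lemma greatest_inf:
  assumes "\<exists>i. greatest A i (Lower A S)"
  shows "greatest A (\<Sqinter>\<^bsub>A\<^esub>S) (Lower A S)"
  unfolding inf_def using assms by (rule someI_ex)

lemma least_sup:
  assumes "\<exists>s. least A s (Upper A S)"
  shows "least A (\<Squnion>\<^bsub>A\<^esub>S) (Upper A S)"
  unfolding sup_def using assms by (rule someI_ex)

lemma lift2_eq_Some_iff: "lift2 h x y = Some z \<longleftrightarrow> (\<exists>a b. x = Some a \<and> y = Some b \<and> z = h a b)"
  by (cases x; cases y) auto

section \<open>Truth values in a structure over an MTL-algebra\<close>

locale mtl_structure = mtl_algebra A for A :: "'a mtl" (structure) +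
  fixes L :: "('f, 'p) lang" and M :: "('f, 'p, 'a, 'm) struct"
  assumes is_struct: "is_struct L A M"
begin

lemma trm_val_closed:
  assumes "range v \<subseteq> dom M"
  shows "wf_trm L t \<Longrightarrow> trm_val M v t \<in> dom M"
proof (induction t)
  case (Var x)
  then show ?case using assms by auto
next
  case (Fun f ts)
  then have "set (map (trm_val M v) ts) \<subseteq> dom M"
    by (auto simp: list_all_iff)
  then show ?case
    using Fun.prems is_struct by (simp add: is_struct_def)
qed

text \<open>The algebraic laws hold on the carrier only, so every defined value has to be placed
  there first. Well-formedness enters because \<open>is_struct\<close> constrains only symbols of
  \<open>L\<close> applied with the right arity.\<close>

lemma truth_val_closed:
  "wf_fm L \<phi> \<Longrightarrow> range v \<subseteq> dom M \<Longrightarrow> truth_val A M \<phi> v = Some a \<Longrightarrow> a \<in> carrier A"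
proof (induction \<phi> arbitrary: v a)
  case (Pred p ts)
  then have "set (map (trm_val M v) ts) \<subseteq> dom M"
    using trm_val_closed by auto
  then show ?case
    using Pred is_struct by (auto simp: is_struct_def)
next
  case (All x \<phi>)
  then show ?case
    using greatest_closed[OF greatest_inf[of A]]
    by (auto simp: inf_option_def split: if_splits)
next
  case (Ex x \<phi>)
  then show ?case
    using least_closed[OF least_sup[of A]]
    by (auto simp: sup_option_def split: if_splits)
qed (auto simp: lift2_eq_Some_iff star_closed residuum_closed)

text \<open>\<open>star\<close> and \<open>meet\<close> reach \<open>\<top>\<close> under the same
  condition, which allows Horn and w-Horn clauses to be treated at once through a variable
  \<open>c\<close>. An undefined conjunct makes both sides false.\<close>

lemma truth_val_conj_eq_top_iff:
  assumes "c = SConj \<or> c = WConj" "wf_fm L (c \<phi> \<psi>)" "range v \<subseteq> dom M"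
  shows "truth_val A M (c \<phi> \<psi>) v = Some \<top> \<longleftrightarrow>
    truth_val A M \<phi> v = Some \<top> \<and> truth_val A M \<psi> v = Some \<top>"
  using assms truth_val_closed[of \<phi> v] truth_val_closed[of \<psi> v]
  by (cases "truth_val A M \<phi> v"; cases "truth_val A M \<psi> v")
     (auto simp: star_eq_top_iff meet_eq_top_iff)

lemma truth_val_modus_ponens:
  assumes "wf_fm L (Imp \<phi> \<psi>)" "range v \<subseteq> dom M"
    and "truth_val A M (Imp \<phi> \<psi>) v = Some \<top>" "truth_val A M \<phi> v = Some \<top>"
  shows "truth_val A M \<psi> v = Some \<top>"
  using assms truth_val_closed[of \<psi> v]
  by (cases "truth_val A M \<psi> v") (auto simp: residuum_eq_top_iff top_le_iff)

lemma truth_val_All_eq_top_iff: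
  assumes "wf_fm L (All x \<phi>)" "range v \<subseteq> dom M"
  shows "truth_val A M (All x \<phi>) v = Some \<top> \<longleftrightarrow>
    (\<forall>m \<in> dom M. truth_val A M \<phi> (v(x := m)) = Some \<top>)"
proof
  let ?S = "(\<lambda>m. truth_val A M \<phi> (v(x := m))) ` dom M"
  assume top: "truth_val A M (All x \<phi>) v = Some \<top>"
  then have "None \<notin> ?S" and ex: "\<exists>i. greatest A i (Lower A (the ` ?S))"
    and inf: "\<Sqinter>(the ` ?S) = \<top>"
    by (auto simp: inf_option_def split: if_splits)
  show "\<forall>m \<in> dom M. truth_val A M \<phi> (v(x := m)) = Some \<top>"
  proof
    fix m
    assume m: "m \<in> dom M"
    then have "truth_val A M \<phi> (v(x := m)) \<in> ?S"
      by (rule imageI)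
    with \<open>None \<notin> ?S\<close> obtain a where a: "truth_val A M \<phi> (v(x := m)) = Some a"
      by (cases "truth_val A M \<phi> (v(x := m))") auto
    have "a \<in> carrier A"
      using truth_val_closed[OF _ _ a] assms m by auto
    moreover have "a \<in> the ` ?S"
      using \<open>truth_val A M \<phi> (v(x := m)) \<in> ?S\<close> a by (metis imageI option.sel)
    \<comment> \<open>The chosen infimum is a lower bound of the instances, and it equals
      \<open>\<top>\<close>.\<close>
    moreover have "\<top> \<in> Lower A (the ` ?S)"
      using greatest_inf[OF ex] inf greatest_mem by metis
    ultimately have "\<top> \<sqsubseteq> a"
      by (auto simp: Lower_def)
    then show "truth_val A M \<phi> (v(x := m)) = Some \<top>"
      using a \<open>a \<in> carrier A\<close> top_le_iff by simp
  qed
next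
  let ?S = "(\<lambda>m. truth_val A M \<phi> (v(x := m))) ` dom M"
  assume "\<forall>m \<in> dom M. truth_val A M \<phi> (v(x := m)) = Some \<top>"
  then have sub: "?S \<subseteq> {Some \<top>}"
    by auto
  then have "the ` ?S \<subseteq> {\<top>}"
    by auto
  \<comment> \<open>A subset of \<open>{\<top>}\<close> has the infimum \<open>\<top>\<close>
    without any completeness of \<open>A\<close>; uniqueness then determines the choice made by
    \<open>inf\<close>.\<close>
  then have top: "greatest A \<top> (Lower A (the ` ?S))"
    by (rule greatest_Lower_top)
  then have "\<Sqinter>(the ` ?S) = \<top>"
    using greatest_unique[OF greatest_inf[of A] top] by blast
  then show "truth_val A M (All x \<phi>) v = Some \<top>"
    using top sub by (auto simp: inf_option_def)
qed

end


section \<open>The two-valued algebra\<close>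

lemma two_simps [simp]:
  "carrier two = UNIV" "le two = (\<le>)" "eq two = (=)" "star two = (\<and>)" "residuum two = (\<longrightarrow>)"
  by (simp_all add: two_def)

lemma top_two [simp]: "\<top>\<^bsub>two\<^esub> = True"
  unfolding top_def by (rule some_equality) (auto simp: greatest_def)

lemma bottom_two [simp]: "\<bottom>\<^bsub>two\<^esub> = False"
  unfolding bottom_def by (rule some_equality) (auto simp: least_def)

text \<open>Serves prelinearity in \<open>mtl_algebra_two\<close>, where the join has to be computed
  from its definition by \<open>SOME\<close>.\<close>

lemma join_two [simp]: "x \<squnion>\<^bsub>two\<^esub> y \<longleftrightarrow> x \<or> y"
proof -
  have "least two z (Upper two {x, y}) \<longleftrightarrow> z = (x \<or> y)" for z
    by (auto simp: least_def Upper_def)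
  then show ?thesis
    by (simp add: join_def sup_def)
qed

lemma mtl_algebra_two: "mtl_algebra two"
proof
  show "\<exists>s. least two s (Upper two {x, y})" for x y
    by (rule exI[of _ "x \<or> y"]) (auto simp: least_def Upper_def)
  show "\<exists>s. greatest two s (Lower two {x, y})" for x y
    by (rule exI[of _ "x \<and> y"]) (auto simp: greatest_def Lower_def)
  show "\<exists>x. least two x (carrier two)"
    by (rule exI[of _ False]) (auto simp: least_def)
  show "\<exists>x. greatest two x (carrier two)"
    by (rule exI[of _ True]) (auto simp: greatest_def)
qed auto


section \<open>Herbrand structures\<close>

lemma ground_terms_Fun:
  "f \<in> funs L \<Longrightarrow> length ts = farity L f \<Longrightarrow> set ts \<subseteq> ground_terms L \<Longrightarrow>
    Fun f ts \<in> ground_terms L"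
  by (auto simp: ground_terms_def list_all_iff)

lemma is_struct_H_struct:
  assumes "\<exists>c \<in> funs L. farity L c = 0" and "is_H_struct L H N"
  shows "is_struct L two N"
proof -
  obtain c where "c \<in> funs L" "farity L c = 0"
    using assms(1) by blast
  \<comment> \<open>The individual constant is what makes the domain of ground terms
    nonempty.\<close>
  then have "Fun c [] \<in> ground_terms L"
    by (auto intro: ground_terms_Fun)
  then show ?thesis
    using assms(2) unfolding is_struct_def is_H_struct_def
    by (auto intro: ground_terms_Fun)
qed

lemma mtl_structure_H_struct:
  assumes "\<exists>c \<in> funs L. farity L c = 0" and "is_H_struct L H N"
  shows "mtl_structure two L N"
  using assms by (simp add: mtl_structure_def mtl_structure_axioms_def mtl_algebra_two is_struct_H_struct)

text \<open>A 0-ary predicate, whose value \<open>H\<close> leaves open, is also true exactly if its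
  value in \<open>M\<close> is \<open>\<top>\<close>. The valuation \<open>v\<close> only feeds
  \<open>trm_val\<close>: ground terms have the same value under every \<open>v\<close>.\<close>

definition herbrand_struct ::
  "('f, 'p) lang \<Rightarrow> 'a mtl \<Rightarrow> ('f, 'p, 'a, 'm) struct \<Rightarrow> (nat \<Rightarrow> 'm) \<Rightarrow>
    ('f, 'p, bool, 'f trm) struct" where
  "herbrand_struct L A M v =
     \<lparr>dom = ground_terms L, fun_of = Fun,
      pred_of = (\<lambda>p ts. pred_of M p (map (trm_val M v) ts) = \<top>\<^bsub>A\<^esub>)\<rparr>"

lemma is_H_struct_herbrand_struct:
  "is_H_struct L {Pred p ts | p ts. Pred p ts \<in> ground_atoms L \<and>
      pred_of M p (map (trm_val M v) ts) = \<top>\<^bsub>A\<^esub>} (herbrand_struct L A M v)"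
  by (auto simp: is_H_struct_def herbrand_struct_def ground_atoms_def)

lemma herbrand_struct_simps [simp]:
  "dom (herbrand_struct L A M v) = ground_terms L"
  "fun_of (herbrand_struct L A M v) = Fun"
  "pred_of (herbrand_struct L A M v) p ts \<longleftrightarrow> pred_of M p (map (trm_val M v) ts) = \<top>\<^bsub>A\<^esub>"
  by (simp_all add: herbrand_struct_def)

text \<open>The substitution lemma: in a term structure the evaluation \<open>w\<close> acts as a
  substitution.\<close>

lemma trm_val_herbrand_struct:
  "trm_val M v (trm_val (herbrand_struct L A M v) w t) = trm_val M (\<lambda>x. trm_val M v (w x)) t"
  by (induction t) (simp_all cong: map_cong)

text \<open>Equality is excluded because distinct ground terms may denote one element of
  \<open>M\<close>; nontriviality settles the case \<open>Zero\<close>.\<close>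

lemma truth_val_atomic_herbrand_struct:
  assumes "atomic \<phi>" "equality_free \<phi>" "\<bottom>\<^bsub>A\<^esub> \<noteq> \<top>\<^bsub>A\<^esub>"
  shows "truth_val two (herbrand_struct L A M v) \<phi> w = Some True \<longleftrightarrow>
    truth_val A M \<phi> (\<lambda>x. trm_val M v (w x)) = Some \<top>\<^bsub>A\<^esub>"
  using assms by (cases \<phi>) (simp_all add: trm_val_herbrand_struct cong: map_cong)

section \<open>Transfer of the value 1 from a model to its Herbrand structure\<close>

locale herbrand = mtl_structure A L M for A :: "'a mtl" (structure)
    and L :: "('f, 'p) lang" and M :: "('f, 'p, 'a, 'm) struct" +
  fixes v :: "nat \<Rightarrow> 'm" and c :: "('f, 'p) fm \<Rightarrow> ('f, 'p) fm \<Rightarrow> ('f, 'p) fm"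
  assumes nontrivial: "\<bottom> \<noteq> \<top>"
    and ground_constant: "\<exists>f \<in> funs L. farity L f = 0"
    and range_v: "range v \<subseteq> dom M"
    and connective: "c = SConj \<or> c = WConj"
begin

abbreviation N :: "('f, 'p, bool, 'f trm) struct" where
  "N \<equiv> herbrand_struct L A M v"

text \<open>Makes the criteria for the value 1 available on both sides of the transfer.\<close>

sublocale N: mtl_structure two L N
  using ground_constant is_H_struct_herbrand_struct by (rule mtl_structure_H_struct)

lemma range_trm_val_comp: "range w \<subseteq> ground_terms L \<Longrightarrow> range (\<lambda>x. trm_val M v (w x)) \<subseteq> dom M"
  using trm_val_closed[OF range_v] by (auto simp: ground_terms_def)

lemma wf_fm_conj [simp]: "wf_fm L (c \<phi> \<psi>) \<longleftrightarrow> wf_fm L \<phi> \<and> wf_fm L \<psi>"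
  and equality_free_conj [simp]: "equality_free (c \<phi> \<psi>) \<longleftrightarrow> equality_free \<phi> \<and> equality_free \<psi>"
  using connective by auto

context
  fixes w :: "nat \<Rightarrow> 'f trm"
  assumes w: "range w \<subseteq> ground_terms L"
begin

text \<open>Meant for the outer conjunction, whose basic Horn conjuncts transfer in one direction
  only.\<close>

lemma truth_val_conj_of_mono:
  assumes "conj_of c P \<phi>" "wf_fm L \<phi>" "equality_free \<phi>"
    and "\<And>\<psi>. P \<psi> \<Longrightarrow> wf_fm L \<psi> \<Longrightarrow> equality_free \<psi> \<Longrightarrow>
      truth_val A M \<psi> (\<lambda>x. trm_val M v (w x)) = Some \<top> \<Longrightarrow> truth_val two N \<psi> w = Some True"
    and "truth_val A M \<phi> (\<lambda>x. trm_val M v (w x)) = Some \<top>"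
  shows "truth_val two N \<phi> w = Some True"
  using assms
proof (induction rule: conj_of.induct)
  case (conj \<phi> \<psi>)
  then show ?case
    using truth_val_conj_eq_top_iff[OF connective _ range_trm_val_comp[OF w], of \<phi> \<psi>]
      N.truth_val_conj_eq_top_iff[OF connective, of \<phi> \<psi> w] w by simp
qed simp

text \<open>Premises of an implication must transfer back from \<open>N\<close> to \<open>M\<close>,
  hence the equivalence. Definedness is recorded because \<open>lift2\<close> gives an implication a
  value only if both sides have one.\<close>

lemma truth_val_conj_of_atomic:
  assumes "conj_of c atomic \<phi>" "wf_fm L \<phi>" "equality_free \<phi>"
  shows "truth_val two N \<phi> w = Some True \<longleftrightarrow> truth_val A M \<phi> (\<lambda>x. trm_val M v (w x)) = Some \<top>"
    and "truth_val two N \<phi> w \<noteq> None"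
proof -
  show "truth_val two N \<phi> w = Some True \<longleftrightarrow> truth_val A M \<phi> (\<lambda>x. trm_val M v (w x)) = Some \<top>"
    using assms
  proof (induction rule: conj_of.induct)
    case (single \<phi>)
    then show ?case
      using truth_val_atomic_herbrand_struct nontrivial by blast
  next
    case (conj \<phi> \<psi>)
    then show ?case
      using truth_val_conj_eq_top_iff[OF connective _ range_trm_val_comp[OF w], of \<phi> \<psi>]
        N.truth_val_conj_eq_top_iff[OF connective, of \<phi> \<psi> w] w by simp
  qed
  show "truth_val two N \<phi> w \<noteq> None"
    using assms(1)
  proof (induction rule: conj_of.induct)
    case (single \<phi>)
    then show ?case by (cases \<phi>) auto
  next
    case (conj \<phi> \<psi>)
    then show ?case using connective by auto
  qed
qed

lemma truth_val_basic_horn: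
  assumes "basic_horn_with c \<phi>" "wf_fm L \<phi>" "equality_free \<phi>"
    and top: "truth_val A M \<phi> (\<lambda>x. trm_val M v (w x)) = Some \<top>"
  shows "truth_val two N \<phi> w = Some True"
  using assms(1) unfolding basic_horn_with_def
proof (elim disjE exE conjE)
  assume "atomic \<phi>"
  then show ?thesis
    using truth_val_atomic_herbrand_struct assms nontrivial by blast
next
  fix \<alpha> \<beta>
  assume \<phi>: "\<phi> = Imp \<alpha> \<beta>" and \<alpha>: "conj_of c atomic \<alpha>" and \<beta>: "atomic \<beta>"
  have wf: "wf_fm L \<alpha>" "equality_free \<alpha>" "wf_fm L \<beta>" "equality_free \<beta>"
    using assms \<phi> by auto
  have "truth_val A M \<alpha> (\<lambda>x. trm_val M v (w x)) = Some \<top> \<Longrightarrow>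
      truth_val A M \<beta> (\<lambda>x. trm_val M v (w x)) = Some \<top>"
    using truth_val_modus_ponens[OF _ range_trm_val_comp[OF w]] assms(2) top \<phi> by blast
  \<comment> \<open>Go back to \<open>M\<close> on \<open>\<alpha>\<close>, apply modus ponens
    there, and return to \<open>N\<close> on \<open>\<beta>\<close>, read as a conjunction of one
    atom.\<close>
  then have "truth_val two N \<alpha> w = Some True \<Longrightarrow> truth_val two N \<beta> w = Some True"
    using truth_val_conj_of_atomic[OF \<alpha>] truth_val_conj_of_atomic[OF conj_of.single[of atomic, OF \<beta>]]
      wf by simp
  \<comment> \<open>Here two-valuedness enters: a defined premise that is not true is false, and
    then the implication holds.\<close>
  then show ?thesis
    using truth_val_conj_of_atomic(2)[OF \<alpha>]
      truth_val_conj_of_atomic(2)[OF conj_of.single[of atomic, OF \<beta>]] wf \<phi> by auto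
qed

end

lemma truth_val_horn_clause:
  assumes "horn_clause_with c \<phi>" "wf_fm L \<phi>" "equality_free \<phi>" "range w \<subseteq> ground_terms L"
    and "truth_val A M \<phi> (\<lambda>x. trm_val M v (w x)) = Some \<top>"
  shows "truth_val two N \<phi> w = Some True"
  using assms
proof (induction arbitrary: w rule: horn_clause_with.induct)
  case (quantifier_free \<gamma>)
  then show ?case
    using truth_val_conj_of_mono[of w "basic_horn_with c" \<gamma>] truth_val_basic_horn[of w] by simp
next
  case (universal \<phi> x)
  \<comment> \<open>Each ground term names an element of \<open>M\<close>, so the instances over
    \<open>N\<close> correspond to some of the instances over \<open>M\<close>.\<close>
  have "truth_val two N \<phi> (w(x := t)) = Some True" if t: "t \<in> ground_terms L" for t
  proof (rule universal.IH)
    show w': "range (w(x := t)) \<subseteq> ground_terms L"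
      using universal.prems(3) t by auto
    have "trm_val M v t \<in> dom M"
      using trm_val_closed[OF range_v] t by (simp add: ground_terms_def)
    then have "truth_val A M \<phi> ((\<lambda>y. trm_val M v (w y))(x := trm_val M v t)) = Some \<top>"
      using truth_val_All_eq_top_iff universal.prems range_trm_val_comp by metis
    moreover have "(\<lambda>y. trm_val M v (w y))(x := trm_val M v t) = (\<lambda>y. trm_val M v ((w(x := t)) y))"
      by auto
    ultimately show "truth_val A M \<phi> (\<lambda>y. trm_val M v ((w(x := t)) y)) = Some \<top>"
      by metis
  qed (use universal.prems in simp_all)
  then show ?case
    using N.truth_val_All_eq_top_iff[of x \<phi> w] universal.prems by simp
qed

end

theorem corollary2:
  fixes L :: "('f, 'p) lang" and \<phi> :: "('f, 'p) fm"
  assumes "preds L \<noteq> {}"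
    and "\<exists>c \<in> funs L. farity L c = 0"
    and "sentence L \<phi>"
    and "equality_free \<phi>"
    and "horn_clause \<phi> \<or> w_horn_clause \<phi>"
  shows "(has_model TYPE('a) TYPE('m) L {\<phi>} \<longrightarrow> has_H_model L {\<phi>}) \<and>
         (has_H_model L {\<phi>} \<longrightarrow> has_model TYPE(bool) TYPE('f trm) L {\<phi>})"
proof (intro conjI impI)
  assume "has_model TYPE('a) TYPE('m) L {\<phi>}"
  then obtain A :: "'a mtl" and M :: "('f, 'p, 'a, 'm) struct" where
    A: "mtl_algebra A" "\<bottom>\<^bsub>A\<^esub> \<noteq> \<top>\<^bsub>A\<^esub>" and M: "is_struct L A M" "is_model A M {\<phi>}"
    unfolding has_model_def by blast
  \<comment> \<open>Any element yields a constant valuation under which ground terms can be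
    interpreted.\<close>
  obtain m where "m \<in> dom M"
    using M(1) by (auto simp: is_struct_def)
  define v :: "nat \<Rightarrow> 'm" where "v = (\<lambda>_. m)"
  have v: "range v \<subseteq> dom M"
    using \<open>m \<in> dom M\<close> by (auto simp: v_def)
  obtain c where c: "c = SConj \<or> c = WConj" "horn_clause_with c \<phi>"
    using assms(5) unfolding horn_clause_def w_horn_clause_def by blast
  interpret herbrand A L M v c
    using A M(1) assms(2) v c(1)
    by (simp add: herbrand_def herbrand_axioms_def mtl_structure_def mtl_structure_axioms_def)
  have "truth_val two N \<phi> w = Some True" if w: "range w \<subseteq> ground_terms L" for w
  proof (rule truth_val_horn_clause[OF c(2) _ assms(4) w])
    show "wf_fm L \<phi>"
      using assms(3) by (simp add: sentence_def)
    show "truth_val A M \<phi> (\<lambda>x. trm_val M v (w x)) = Some \<top>\<^bsub>A\<^esub>"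
      using M(2) range_trm_val_comp[OF w] unfolding is_model_def by blast
  qed
  then have "is_model two N {\<phi>}"
    by (simp add: is_model_def)
  moreover have "{Pred p ts | p ts. Pred p ts \<in> ground_atoms L \<and>
      pred_of M p (map (trm_val M v) ts) = \<top>\<^bsub>A\<^esub>} \<subseteq> ground_atoms L"
    by auto
  ultimately show "has_H_model L {\<phi>}"
    using is_H_struct_herbrand_struct[of L M v A] unfolding has_H_model_def by blast
next
  assume "has_H_model L {\<phi>}"
  then obtain H N where "is_H_struct L H N" "is_model two N {\<phi>}"
    unfolding has_H_model_def by blast
  \<comment> \<open>The H-structure is itself the required model, over the nontrivial algebra
    \<open>two\<close>.\<close>
  then show "has_model TYPE(bool) TYPE('f trm) L {\<phi>}"
    using is_struct_H_struct[OF assms(2)] mtl_algebra_two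
    unfolding has_model_def by (intro exI[of _ two] exI[of _ N]) simp
qed

end
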